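(* Let $r\ge1$ be an integer. Then the normal ordering of $X^r+D^r$ corresponds to the continued fraction expansion $$\sum_{n\ge0}\mathrm{CT}\bigl((X^r+D^r)^n\bigr)z^n\;=\;\mathrm{CT}\left(\frac{1}{1-z(X^r+D^r)}\right)=\cfrac{1}{1-\cfrac{1^{\overline r}\cdot z^2}{1-\cfrac{(r+1)^{\overline r}\cdot z^2}{1-\cfrac{(2r+1)^{\overline r}\cdot z^2}{\ddots}}}}\,,$$ where $x^{\overline r}=x(x+1)\cdots(x+r-1)$.
   Context: The operators satisfy $DX-XD=1$ (e.g. $Xf(x)=xf(x)$, $D=d/dx$). Every polynomial $H$ in $X,D$ has a unique normal form $\sum_{\alpha,\beta\ge0}c_{\alpha,\beta}X^\alpha D^\beta$; its constant term is $\mathrm{CT}(H):=c_{0,0}$. $\mathrm{CT}$ is extended coefficientwise to formal power series in $z$, and $\frac{1}{1-z\mathfrak h}:=\sum_{n\ge0}z^n\mathfrak h^n$, which is the formal Laplace transform (sending $\sum f_nz^n/n!$ to $\sum f_nz^n$) of $e^{z\mathfrak h}$. The continued fraction is a formal power series in $z$; the $j$-th numerator ($j\ge1$) is $((j-1)r+1)^{\overline r}z^2$. *)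

theory Defs
  imports "HOL-Computational_Algebra.Computational_Algebra"
begin

section \<open>Pairs of operators with \<open>D * X - X * D = 1\<close>\<close>

text \<open>
  The operators are elements of an arbitrary nonzero associative unital algebra over a field of
  characteristic 0. Nothing is assumed about the algebra beyond the commutation relation: for a
  nonzero algebra over such a field it already forces the monomials \<open>X ^ a * D ^ b\<close> to be linearly
  independent (\<open>normal_form_unique\<close> below).
\<close>

locale weyl_pair = vector_space scale
  for scale :: "'k::field_char_0 \<Rightarrow> 'a::ring_1 \<Rightarrow> 'a" (infixr \<open>*s\<close> 75) +
  fixes X D :: 'a
  assumes scale_mult_left: "(c *s u) * v = c *s (u * v)"
    and scale_mult_right: "u * (c *s v) = c *s (u * v)"
    and commutation: "D * X - X * D = 1"

definition is_normal_form ::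
  "('k::field_char_0 \<Rightarrow> 'a::ring_1 \<Rightarrow> 'a) \<Rightarrow> 'a \<Rightarrow> 'a \<Rightarrow> 'a \<Rightarrow> (nat \<times> nat \<Rightarrow> 'k) \<Rightarrow> bool" where
  "is_normal_form scale X D H c \<longleftrightarrow>
     finite {p. c p \<noteq> 0} \<and>
     H = (\<Sum>(\<alpha>, \<beta>) \<in> {p. c p \<noteq> 0}. scale (c (\<alpha>, \<beta>)) (X ^ \<alpha> * D ^ \<beta>))"

definition CT ::
  "('k::field_char_0 \<Rightarrow> 'a::ring_1 \<Rightarrow> 'a) \<Rightarrow> 'a \<Rightarrow> 'a \<Rightarrow> 'a \<Rightarrow> 'k" where
  "CT scale X D H = (THE c. is_normal_form scale X D H c) (0, 0)"

definition CT_fps ::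
  "('k::field_char_0 \<Rightarrow> 'a::ring_1 \<Rightarrow> 'a) \<Rightarrow> 'a \<Rightarrow> 'a \<Rightarrow> 'a fps \<Rightarrow> 'k fps" where
  "CT_fps scale X D F = Abs_fps (\<lambda>n. CT scale X D (fps_nth F n))"

text \<open>
  The series \<open>1 / (1 - z * h)\<close>. It is defined by its coefficients because the library's division of
  power series is intended for coefficients in a division ring; \<open>geometric_inverse\<close> shows that it is
  the two-sided inverse.
\<close>

definition geometric :: "'a::ring_1 \<Rightarrow> 'a fps" where
  "geometric h = Abs_fps (\<lambda>n. h ^ n)"

lemma geometric_inverse:
  "(1 - fps_X * fps_const h) * geometric h = 1"
  "geometric h * (1 - fps_X * fps_const h) = 1"
proof -
  show "(1 - fps_X * fps_const h) * geometric h = 1"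
  proof (rule fps_ext)
    fix n show "fps_nth ((1 - fps_X * fps_const h) * geometric h) n = fps_nth 1 n"
      by (cases n) (simp_all add: geometric_def left_diff_distrib mult.assoc)
  qed
  show "geometric h * (1 - fps_X * fps_const h) = 1"
  proof (rule fps_ext)
    fix n show "fps_nth (geometric h * (1 - fps_X * fps_const h)) n = fps_nth 1 n"
      by (cases n) (simp_all add: geometric_def right_diff_distrib power_commutes
            flip: mult.assoc)
  qed
qed

subsection \<open>Uniqueness of normal forms\<close>

context weyl_pair
begin

lemma scale_sum_monom_diff:
  assumes "is_normal_form scale X D H c" "is_normal_form scale X D H d"
  shows "(\<Sum>p\<in>{p. c p \<noteq> 0} \<union> {p. d p \<noteq> 0}. (c p - d p) *s (X ^ fst p * D ^ snd p)) = 0"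
proof -
  let ?U = "{p. c p \<noteq> 0} \<union> {p. d p \<noteq> 0}"
  have fin: "finite ?U" using assms by (auto simp: is_normal_form_def)
  have 1: "H = (\<Sum>p\<in>?U. c p *s (X ^ fst p * D ^ snd p))"
    using assms(1) fin unfolding is_normal_form_def
    by (auto simp: case_prod_beta intro!: sum.mono_neutral_left)
  have 2: "H = (\<Sum>p\<in>?U. d p *s (X ^ fst p * D ^ snd p))"
    using assms(2) fin unfolding is_normal_form_def
    by (auto simp: case_prod_beta intro!: sum.mono_neutral_left)
  show ?thesis
    using 1 2 by (simp add: scale_left_diff_distrib sum_subtractf)
qed

lemma scale_of_nat_Suc: "of_nat (Suc n) *s v = of_nat n *s v + v"
  by (simp add: scale_left_distrib add.commute)

lemma D_power_X: "D ^ b * X - X * D ^ b = of_nat b *s D ^ (b - 1)"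
proof (induction b)
  case (Suc b)
  have "D ^ Suc b * X - X * D ^ Suc b
        = D * (D ^ b * X - X * D ^ b) + (D * X - X * D) * D ^ b"
    by (simp add: algebra_simps)
  also have "\<dots> = of_nat b *s (D * D ^ (b - 1)) + D ^ b"
    by (simp add: Suc commutation scale_mult_right)
  also have "\<dots> = of_nat (Suc b) *s D ^ (Suc b - 1)"
    by (cases b) (simp_all add: scale_of_nat_Suc del: of_nat_Suc)
  finally show ?case .
qed simp

lemma D_X_power: "D * X ^ a - X ^ a * D = of_nat a *s X ^ (a - 1)"
proof (induction a)
  case (Suc a)
  have "D * X ^ Suc a - X ^ Suc a * D
        = X * (D * X ^ a - X ^ a * D) + (D * X - X * D) * X ^ a"
    by (simp add: algebra_simps)
  also have "\<dots> = of_nat a *s (X * X ^ (a - 1)) + X ^ a"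
    by (simp add: Suc commutation scale_mult_right)
  also have "\<dots> = of_nat (Suc a) *s X ^ (Suc a - 1)"
    by (cases a) (simp_all add: scale_of_nat_Suc del: of_nat_Suc)
  finally show ?case .
qed simp

lemma normal_form_unique:
  assumes "is_normal_form scale X D H c" "is_normal_form scale X D H d"
  shows "c = d"
proof (rule ccontr)
  assume "c \<noteq> d"
  define U where "U = {p. c p \<noteq> 0} \<union> {p. d p \<noteq> 0}"
  define e where "e = (\<lambda>p. c p - d p)"
  define S where "S = {p. e p \<noteq> 0}"
  have finU: "finite U" using assms by (auto simp: is_normal_form_def U_def)
  have SU: "S \<subseteq> U" by (auto simp: S_def U_def e_def)
  then have finS: "finite S" using finU by (rule finite_subset)
  have neS: "S \<noteq> {}" using \<open>c \<noteq> d\<close> by (auto simp: S_def e_def)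
  have zero: "(\<Sum>p\<in>S. e p *s (X ^ fst p * D ^ snd p)) = 0"
  proof -
    have "(\<Sum>p\<in>S. e p *s (X ^ fst p * D ^ snd p)) = (\<Sum>p\<in>U. e p *s (X ^ fst p * D ^ snd p))"
      using finU SU by (intro sum.mono_neutral_left) (auto simp: S_def)
    also have "\<dots> = 0"
      using scale_sum_monom_diff[OF assms] by (simp add: U_def e_def)
    finally show ?thesis .
  qed
  have XD: "(\<Sum>p\<in>S. (e p * of_nat (\<Prod>i<k. snd p - i)) *s (X ^ fst p * D ^ (snd p - k))) = 0" for k
  proof (induction k)
    case (Suc k)
    let ?G = "\<lambda>k. (\<Sum>p\<in>S. (e p * of_nat (\<Prod>i<k. snd p - i)) *s (X ^ fst p * D ^ (snd p - k)))"
    have *: "X ^ a * D ^ b * X - X * (X ^ a * D ^ b) = of_nat b *s (X ^ a * D ^ (b - 1))" for a b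
    proof -
      have "X ^ a * D ^ b * X - X * (X ^ a * D ^ b) = X ^ a * (D ^ b * X - X * D ^ b)"
        by (simp add: algebra_simps power_commutes flip: mult.assoc)
      then show ?thesis by (simp add: D_power_X scale_mult_right)
    qed
    have "?G k * X - X * ?G k = (\<Sum>p\<in>S. (e p * of_nat (\<Prod>i<k. snd p - i)) *s
            (X ^ fst p * D ^ (snd p - k) * X - X * (X ^ fst p * D ^ (snd p - k))))"
      by (simp add: sum_distrib_left sum_distrib_right scale_mult_left scale_mult_right
            sum_subtractf scale_right_diff_distrib)
    also have "\<dots> = ?G (Suc k)"
      unfolding * by (simp add: mult_ac)
    finally show ?case using Suc by simp
  qed (use zero in simp)
  define B where "B = Max (snd ` S)"
  define A where "A = {p \<in> S. snd p = B}"
  have leB: "snd p \<le> B" if "p \<in> S" for p using that finS by (simp add: B_def)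
  have finA: "finite A" using finS by (simp add: A_def)
  have neA: "A \<noteq> {}"
  proof -
    have "B \<in> snd ` S" unfolding B_def using finS neS by (intro Max_in) auto
    then show ?thesis by (auto simp: A_def)
  qed
  define f where "f p = e p * of_nat (\<Prod>i<B. snd p - i)" for p
  have f0: "f p \<noteq> 0" if "p \<in> A" for p using that by (auto simp: A_def f_def S_def)
  have zeroA: "(\<Sum>p\<in>A. f p *s X ^ fst p) = 0"
  proof -
    have "0 = (\<Sum>p\<in>S. f p *s (X ^ fst p * D ^ (snd p - B)))"
      using XD[of B] by (simp add: f_def)
    also have "\<dots> = (\<Sum>p\<in>A. f p *s (X ^ fst p * D ^ (snd p - B)))"
    proof (rule sum.mono_neutral_right[OF finS])
      show "\<forall>p\<in>S - A. f p *s (X ^ fst p * D ^ (snd p - B)) = 0"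
      proof
        fix p assume "p \<in> S - A"
        then have "snd p < B" using leB[of p] by (auto simp: A_def)
        then have "(\<Prod>i<B. snd p - i) = 0" by (auto intro!: prod_zero)
        then have "f p = 0" by (simp add: f_def)
        then show "f p *s (X ^ fst p * D ^ (snd p - B)) = 0" by simp
      qed
    qed (auto simp: A_def)
    also have "\<dots> = (\<Sum>p\<in>A. f p *s X ^ fst p)"
      by (rule sum.cong) (auto simp: A_def)
    finally show ?thesis by simp
  qed
  have XX: "(\<Sum>p\<in>A. (f p * of_nat (\<Prod>i<k. fst p - i)) *s X ^ (fst p - k)) = 0" for k
  proof (induction k)
    case (Suc k)
    let ?G = "\<lambda>k. (\<Sum>p\<in>A. (f p * of_nat (\<Prod>i<k. fst p - i)) *s X ^ (fst p - k))"
    have "D * ?G k - ?G k * D = (\<Sum>p\<in>A. (f p * of_nat (\<Prod>i<k. fst p - i)) *s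
            (D * X ^ (fst p - k) - X ^ (fst p - k) * D))"
      by (simp add: sum_distrib_left sum_distrib_right scale_mult_left scale_mult_right
            sum_subtractf scale_right_diff_distrib)
    also have "\<dots> = ?G (Suc k)"
      unfolding D_X_power by (simp add: mult_ac)
    finally show ?case using Suc by simp
  qed (use zeroA in simp)
  define M where "M = Max (fst ` A)"
  have leM: "fst p \<le> M" if "p \<in> A" for p using that finA by (simp add: M_def)
  have "M \<in> fst ` A" unfolding M_def using finA neA by (intro Max_in) auto
  then obtain q where q: "q \<in> A" "fst q = M" by auto
  have "0 = (\<Sum>p\<in>A. (f p * of_nat (\<Prod>i<M. fst p - i)) *s X ^ (fst p - M))"
    using XX[of M] by simp
  also have "\<dots> = (\<Sum>p\<in>{q}. (f p * of_nat (\<Prod>i<M. fst p - i)) *s X ^ (fst p - M))"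
  proof (rule sum.mono_neutral_right[OF finA])
    show "\<forall>p\<in>A - {q}. (f p * of_nat (\<Prod>i<M. fst p - i)) *s X ^ (fst p - M) = 0"
    proof
      fix p assume p: "p \<in> A - {q}"
      then have "fst p \<noteq> M" using q by (auto simp: A_def prod_eq_iff)
      then have "fst p < M" using leM[of p] p by auto
      then have "(\<Prod>i<M. fst p - i) = 0" by (auto intro!: prod_zero)
      then show "(f p * of_nat (\<Prod>i<M. fst p - i)) *s X ^ (fst p - M) = 0" by (simp del: of_nat_prod)
    qed
  qed (use q in auto)
  also have "\<dots> = (f q * of_nat (\<Prod>i<M. M - i)) *s 1" using q by simp
  finally have "f q * of_nat (\<Prod>i<M. M - i) = 0" by (metis scale_eq_0_iff one_neq_zero)
  then have "f q = 0" by simp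
  then show False using f0 q by simp
qed

end

subsection \<open>The standard example\<close>

text \<open>Multiplication by \<open>x\<close> and differentiation, as elements of the algebra of linear operators on
  polynomials.\<close>

typedef (overloaded) 'k poly_operator =
  "{f :: 'k::field_char_0 poly \<Rightarrow> 'k poly.
      (\<forall>p q. f (p + q) = f p + f q) \<and> (\<forall>c p. f (smult c p) = smult c (f p))}"
  by (rule exI[of _ id]) simp

setup_lifting type_definition_poly_operator

instantiation poly_operator :: (field_char_0) ring_1
begin

lift_definition zero_poly_operator :: "'a poly_operator" is "\<lambda>_. 0" by simp
lift_definition one_poly_operator :: "'a poly_operator" is "\<lambda>p. p" by simp
lift_definition plus_poly_operator :: "'a poly_operator \<Rightarrow> 'a poly_operator \<Rightarrow> 'a poly_operator"
  is "\<lambda>f g p. f p + g p" by (simp add: smult_add_right)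
lift_definition minus_poly_operator :: "'a poly_operator \<Rightarrow> 'a poly_operator \<Rightarrow> 'a poly_operator"
  is "\<lambda>f g p. f p - g p" by (simp add: smult_diff_right)
lift_definition uminus_poly_operator :: "'a poly_operator \<Rightarrow> 'a poly_operator"
  is "\<lambda>f p. - f p" by simp
lift_definition times_poly_operator :: "'a poly_operator \<Rightarrow> 'a poly_operator \<Rightarrow> 'a poly_operator"
  is "\<lambda>f g p. f (g p)" by simp

instance
proof
  show "(0 :: 'a poly_operator) \<noteq> 1"
    by transfer (metis zero_neq_one)
qed (transfer; simp add: fun_eq_iff algebra_simps)+

end

lift_definition scale_operator :: "'k \<Rightarrow> 'k::field_char_0 poly_operator \<Rightarrow> 'k poly_operator"
  is "\<lambda>c f p. smult c (f p)" by (simp add: smult_add_right mult.commute)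
lift_definition X_operator :: "'k::field_char_0 poly_operator" is "\<lambda>p. [:0, 1:] * p"
  by (simp add: smult_add_right)
lift_definition D_operator :: "'k::field_char_0 poly_operator" is pderiv
  by (simp add: pderiv_add pderiv_smult)

lemma weyl_pair_operators: "weyl_pair scale_operator X_operator D_operator"
proof
  show "D_operator * X_operator - X_operator * D_operator = (1 :: 'a poly_operator)"
    by transfer (simp add: fun_eq_iff pderiv_pCons)
qed (transfer; simp add: fun_eq_iff smult_add_right smult_add_left)+

section \<open>Continued fractions of power series\<close>

text \<open>
  The numerators are indexed from 0: the \<open>n\<close>-th convergent is
  \<open>1 / (1 - b 0 / (1 - b 1 / (\<dots> / (1 - b (n - 1)))))\<close>.
  Convergence is with respect to the metric on formal power series, that is, every coefficient of
  the convergents is eventually constant.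
\<close>

primrec convergent_S :: "(nat \<Rightarrow> 'k::field fps) \<Rightarrow> nat \<Rightarrow> 'k fps" where
  "convergent_S b 0 = 1"
| "convergent_S b (Suc n) = 1 / (1 - b 0 * convergent_S (\<lambda>j. b (Suc j)) n)"

definition has_continued_fraction :: "'k::field fps \<Rightarrow> (nat \<Rightarrow> 'k fps) \<Rightarrow> bool" where
  "has_continued_fraction F b \<longleftrightarrow> convergent_S b \<longlonglongrightarrow> F"

end

theory Submission
  imports Defs
begin

text \<open>
  In the standard representation on polynomials, where \<open>X\<close> multiplies by \<open>x\<close> and \<open>D\<close>
  differentiates, a monomial \<open>X ^ a * D ^ b\<close> sends the constant polynomial 1 to \<open>x ^ a\<close> if
  \<open>b = 0\<close> and to 0 otherwise. The constant term of an operator is therefore the constant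
  coefficient of its value at 1 (\<open>CT_eq_coeff_0\<close>; the algebra being abstract, the representation
  is carried along by a relation between operators and polynomials). So one has to study the
  polynomials \<open>P n\<close> that arise from 1 by applying \<open>X ^ r + D ^ r\<close> repeatedly \<open>n\<close> times. Only
  powers of \<open>x ^ r\<close> occur, and since \<open>D ^ r\<close> sends \<open>x ^ ((k + 1) * r)\<close> to
  \<open>pochhammer (k * r + 1) r\<close> times \<open>x ^ (k * r)\<close>, the coefficient of \<open>x ^ (k * r)\<close> in \<open>P n\<close> is the
  total weight of the nonnegative lattice paths with \<open>n\<close> steps \<open>+1\<close> or \<open>-1\<close> from height 0 to
  height \<open>k\<close>, where a down step from height \<open>k + 1\<close> to \<open>k\<close> carries the weight
  \<open>pochhammer (k * r + 1) r\<close> and an up step the weight 1.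

  A path ending at height \<open>k\<close> has at least \<open>k\<close> steps. The generating functions of the paths
  ending at the heights 0, 1, 2, \<dots>, divided by \<open>1, z, z ^ 2, \<dots>\<close>, satisfy a three-term
  recurrence. Read as \<open>f (k + 1) / f k = 1 / (1 - b k * (f (k + 2) / f (k + 1)))\<close> and iterated, such
  a recurrence expands \<open>f 1 / f 0\<close> into a continued fraction, as in Gauss's treatment of
  hypergeometric quotients. Each level gains a factor \<open>b k\<close> divisible by \<open>z\<close> in the error, so the
  expansion converges as a power series (\<open>three_term_recurrence_continued_fraction\<close>).
\<close>

section \<open>Three-term recurrences and continued fractions\<close>

text \<open>
  The \<open>m\<close>-th convergent of the recurrence shifted by 1 approximates \<open>f 2 / f 1\<close>. Substituting it
  into the recurrence for \<open>k = 0\<close> approximates \<open>f 1 / f 0\<close> and multiplies the error by \<open>b 0\<close>, up to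
  a unit. Keeping \<open>f 0\<close> general instead of 1 is what makes the shift possible.
\<close>

lemma three_term_recurrence_convergent_dvd:
  fixes b f :: "nat \<Rightarrow> 'k::field fps"
  assumes "\<And>k. fps_X dvd b k"
    and "\<And>k. f (Suc k) = f k + b k * f (Suc (Suc k))"
  shows "fps_X ^ Suc m dvd f 1 - convergent_S b m * f 0"
  using assms
proof (induction m arbitrary: b f)
  case 0
  have "f 1 - f 0 = b 0 * f 2" using "0.prems"(2)[of 0] by (simp add: numeral_2_eq_2)
  then show ?case using "0.prems"(1)[of 0] by simp
next
  case (Suc m)
  define C where "C = convergent_S (\<lambda>j. b (Suc j)) m"
  define u where "u = 1 - b 0 * C"
  have "fps_X dvd b 0 * C" using Suc.prems(1)[of 0] by simp
  then have "fps_nth (b 0 * C) 0 = 0" by (metis dvdE fps_mult_fps_X_nonzero(1) fps_X_mult_nth)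
  then have u0: "fps_nth u 0 \<noteq> 0" by (auto simp: u_def)
  have "fps_X ^ Suc m dvd f 2 - C * f 1"
    using Suc.IH[of "\<lambda>j. b (Suc j)" "\<lambda>k. f (Suc k)", OF Suc.prems(1) Suc.prems(2)]
    by (simp add: C_def numeral_2_eq_2)
  then have "fps_X * fps_X ^ Suc m dvd b 0 * (f 2 - C * f 1)"
    by (intro mult_dvd_mono Suc.prems(1))
  also have "b 0 * (f 2 - C * f 1) = u * f 1 - f 0"
    using Suc.prems(2)[of 0] by (simp add: u_def algebra_simps numeral_2_eq_2)
  finally have "fps_X ^ Suc (Suc m) dvd inverse u * (u * f 1 - f 0)" by simp
  also have "inverse u * (u * f 1 - f 0) = f 1 - inverse u * f 0"
    using inverse_mult_eq_1[OF u0] by (simp add: right_diff_distrib flip: mult.assoc)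
  also have "inverse u = convergent_S b (Suc m)"
    using u0 by (simp add: u_def C_def fps_divide_unit)
  finally show ?case .
qed

theorem three_term_recurrence_continued_fraction:
  fixes b f :: "nat \<Rightarrow> 'k::field fps"
  assumes "\<And>k. fps_X dvd b k"
    and "\<And>k. f (Suc k) = f k + b k * f (Suc (Suc k))"
    and "f 0 = 1"
  shows "has_continued_fraction (f 1) b"
  unfolding has_continued_fraction_def
proof (rule tendsto_fpsI)
  fix n
  have "fps_nth (convergent_S b m) n = fps_nth (f 1) n" if "m \<ge> n" for m
  proof -
    have "fps_X ^ Suc m dvd f 1 - convergent_S b m"
      using three_term_recurrence_convergent_dvd[where b = b and f = f, OF assms(1,2), of m] assms(3) by simp
    then obtain q where "f 1 - convergent_S b m = fps_X ^ Suc m * q" by (elim dvdE)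
    then have "fps_nth (f 1 - convergent_S b m) n = 0"
      using that by (metis fps_X_power_mult_nth le_imp_less_Suc)
    then show ?thesis by simp
  qed
  then show "eventually (\<lambda>m. fps_nth (convergent_S b m) n = fps_nth (f 1) n) sequentially"
    by (auto simp: eventually_at_top_linorder)
qed

section \<open>Constant terms from the action on polynomials\<close>

context weyl_pair
begin

text \<open>
  Operators that have a normal form, together with their value at the constant polynomial 1 in the
  standard representation. A relation is needed because the given algebra need not act on
  polynomials: elements other than combinations of the \<open>X ^ a * D ^ b\<close> have no value.
\<close>

inductive value_at_1 :: "'a \<Rightarrow> 'k poly \<Rightarrow> bool" where
  zero: "value_at_1 0 0"
| add_monom: "value_at_1 H p \<Longrightarrow>
    value_at_1 (H + c *s (X ^ a * D ^ b)) (p + monom (if b = 0 then c else 0) a)"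

lemma value_at_1_1: "value_at_1 1 1"
  using add_monom[OF zero, of 1 0 0] by simp

lemma value_at_1_add:
  assumes "value_at_1 H p" "value_at_1 K q"
  shows "value_at_1 (H + K) (p + q)"
  using assms(2)
proof induction
  case (add_monom K q c a b)
  then show ?case using value_at_1.add_monom[OF add_monom.IH, of c a b] by (simp add: add.assoc)
qed (use assms(1) in simp)

lemma value_at_1_X: "value_at_1 H p \<Longrightarrow> value_at_1 (X * H) (monom 1 1 * p)"
proof (induction rule: value_at_1.induct)
  case (add_monom H p c a b)
  have "X * (H + c *s (X ^ a * D ^ b)) = X * H + c *s (X ^ Suc a * D ^ b)"
    by (simp add: distrib_left scale_mult_right mult.assoc)
  moreover have "monom 1 1 * (p + monom (if b = 0 then c else 0) a)
      = monom 1 1 * p + monom (if b = 0 then c else 0) (Suc a)"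
    by (simp add: distrib_left mult_monom)
  ultimately show ?case using value_at_1.add_monom[OF add_monom.IH, of c "Suc a" b] by presburger
qed (simp add: value_at_1.zero)

text \<open>
  Commuting \<open>D\<close> past \<open>X ^ a\<close> leaves \<open>a\<close> times \<open>X ^ (a - 1)\<close>, the derivative of \<open>x ^ a\<close>; the other
  term ends in a positive power of \<open>D\<close> and so kills 1.
\<close>

lemma value_at_1_D: "value_at_1 H p \<Longrightarrow> value_at_1 (D * H) (pderiv p)"
proof (induction rule: value_at_1.induct)
  case (add_monom H p c a b)
  let ?d = "\<lambda>b. if b = 0 then c else 0" and ?e = "if b = 0 then of_nat a * c else 0"
  have "D * (X ^ a * D ^ b) = (X ^ a * D + of_nat a *s X ^ (a - 1)) * D ^ b"
    using D_X_power[of a] by (simp add: algebra_simps flip: mult.assoc)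
  then have "D * (H + c *s (X ^ a * D ^ b))
      = D * H + c *s (X ^ a * D ^ Suc b) + (of_nat a * c) *s (X ^ (a - 1) * D ^ b)"
    by (simp add: distrib_left distrib_right scale_mult_right scale_mult_left scale_right_distrib
        mult.assoc mult.commute[of c])
  moreover have "pderiv (p + monom (?d b) a)
      = pderiv p + monom (if Suc b = 0 then c else 0) a + monom ?e (a - 1)"
    by (simp add: pderiv_add pderiv_monom)
  ultimately show ?case
    using value_at_1.add_monom[OF value_at_1.add_monom[OF add_monom.IH],
        of c a "Suc b" "of_nat a * c" "a - 1" b]
    by presburger
qed (simp add: value_at_1.zero)

lemma value_at_1_X_power: "value_at_1 H p \<Longrightarrow> value_at_1 (X ^ r * H) (monom 1 r * p)"
proof (induction r)
  case (Suc r)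
  have "monom 1 (Suc r) = monom 1 1 * (monom 1 r :: 'k poly)" by (simp add: mult_monom)
  then show ?case
    using value_at_1_X[OF Suc.IH[OF Suc.prems]] by (simp only: power_Suc mult.assoc)
qed simp

lemma value_at_1_D_power: "value_at_1 H p \<Longrightarrow> value_at_1 (D ^ r * H) ((pderiv ^^ r) p)"
proof (induction r)
  case (Suc r)
  then show ?case using value_at_1_D[of "D ^ r * H"] by (simp add: mult.assoc)
qed simp

lemma normal_form_if_value_at_1:
  "value_at_1 H p \<Longrightarrow> \<exists>c. is_normal_form scale X D H c \<and> (\<forall>a. c (a, 0) = coeff p a)"
proof (induction rule: value_at_1.induct)
  case zero
  then show ?case by (intro exI[of _ "\<lambda>_. 0"]) (simp add: is_normal_form_def)
next
  case (add_monom H p k a b)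
  then obtain c where c: "is_normal_form scale X D H c" "\<And>a. c (a, 0) = coeff p a" by auto
  define d where "d = c((a, b) := c (a, b) + k)"
  define U where "U = insert (a, b) {p. c p \<noteq> 0}"
  let ?m = "\<lambda>p. X ^ fst p * D ^ snd p"
  have fin: "finite U" using c(1) by (simp add: U_def is_normal_form_def)
  have sub: "{p. c p \<noteq> 0} \<subseteq> U" "{p. d p \<noteq> 0} \<subseteq> U" by (auto simp: U_def d_def)
  have "H = (\<Sum>p\<in>U. c p *s ?m p)"
    using c(1) fin sub(1) unfolding is_normal_form_def
    by (auto simp: case_prod_beta intro!: sum.mono_neutral_left)
  moreover have "k *s (X ^ a * D ^ b) = (\<Sum>p\<in>U. (if p = (a, b) then k *s ?m p else 0))"
    using fin by (simp add: U_def)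
  ultimately have "H + k *s (X ^ a * D ^ b) = (\<Sum>p\<in>U. d p *s ?m p)"
    by (auto simp: d_def scale_left_distrib simp flip: sum.distrib intro!: sum.cong)
  also have "\<dots> = (\<Sum>p\<in>{p. d p \<noteq> 0}. d p *s ?m p)"
    using fin sub(2) by (auto intro!: sum.mono_neutral_right)
  finally have "is_normal_form scale X D (H + k *s (X ^ a * D ^ b)) d"
    using finite_subset[OF sub(2) fin] by (simp add: is_normal_form_def case_prod_beta)
  moreover have "d (i, 0) = coeff (p + monom (if b = 0 then k else 0) a) i" for i
    using c(2) by (auto simp: d_def)
  ultimately show ?case by blast
qed

lemma CT_eq_coeff_0:
  assumes "value_at_1 H p"
  shows "CT scale X D H = coeff p 0"
proof -
  obtain c where c: "is_normal_form scale X D H c" "c (0, 0) = coeff p 0"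
    using normal_form_if_value_at_1[OF assms] by auto
  have "(THE c. is_normal_form scale X D H c) = c"
    using c(1) normal_form_unique by blast
  then show ?thesis using c(2) by (simp add: CT_def)
qed

end

section \<open>Iterating the sum of multiplication by a power and repeated differentiation\<close>

definition X_plus_D_iterate :: "nat \<Rightarrow> nat \<Rightarrow> 'k::field_char_0 poly" where
  "X_plus_D_iterate r n = ((\<lambda>p. monom 1 r * p + (pderiv ^^ r) p) ^^ n) 1"

lemma (in weyl_pair) CT_X_plus_D_power:
  "CT scale X D ((X ^ r + D ^ r) ^ n) = coeff (X_plus_D_iterate r n) 0"
proof (rule CT_eq_coeff_0)
  show "value_at_1 ((X ^ r + D ^ r) ^ n) (X_plus_D_iterate r n)"
    unfolding X_plus_D_iterate_def
  proof (induction n)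
    case (Suc n)
    then show ?case
      using value_at_1_add[OF value_at_1_X_power[OF Suc] value_at_1_D_power[OF Suc]]
      by (simp add: distrib_right)
  qed (simp add: value_at_1_1)
qed

text \<open>
  The weighted path count: the last step of a path comes either from the height below or, with a
  weight, from the height above.
\<close>

lemma coeff_X_plus_D_iterate_Suc:
  assumes "r \<ge> 1"
  shows "coeff (X_plus_D_iterate r (Suc n) :: 'k::field_char_0 poly) (k * r) =
    (if k = 0 then 0 else coeff (X_plus_D_iterate r n) ((k - 1) * r)) +
    pochhammer (of_nat (k * r + 1)) r * coeff (X_plus_D_iterate r n) (Suc k * r)"
  using assms
  by (cases k) (simp_all add: X_plus_D_iterate_def coeff_monom_mult coeff_higher_pderiv add_ac)

lemma coeff_X_plus_D_iterate_eq_0: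
  assumes "r \<ge> 1" "n < k"
  shows "coeff (X_plus_D_iterate r n :: 'k::field_char_0 poly) (k * r) = 0"
  using assms(2)
proof (induction n arbitrary: k)
  case 0
  then show ?case using assms(1) by (simp add: X_plus_D_iterate_def)
next
  case (Suc n)
  then show ?case unfolding coeff_X_plus_D_iterate_Suc[OF assms(1)] by (simp del: mult_Suc)
qed

lemma coeff_X_plus_D_iterate_diag:
  assumes "r \<ge> 1"
  shows "coeff (X_plus_D_iterate r n :: 'k::field_char_0 poly) (n * r) = 1"
proof (induction n)
  case (Suc n)
  then show ?case
    unfolding coeff_X_plus_D_iterate_Suc[OF assms]
    using coeff_X_plus_D_iterate_eq_0[OF assms, where 'k = 'k, of n "Suc (Suc n)"] by (simp del: mult_Suc)
qed (simp add: X_plus_D_iterate_def)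

text \<open>
  With \<open>f (k + 1)\<close> the generating function of the paths ending at height \<open>k\<close>, divided by \<open>z ^ k\<close>, an
  up step leaves the exponent of \<open>z\<close> unchanged and a down step contributes \<open>z ^ 2\<close>; the value
  \<open>f 0 = 1\<close> accounts for the empty path.
\<close>

lemma continued_fraction_X_plus_D_iterate:
  assumes "r \<ge> 1"
  shows "has_continued_fraction
    (Abs_fps (\<lambda>n. coeff (X_plus_D_iterate r n :: 'k::field_char_0 poly) 0))
    (\<lambda>j. fps_const (pochhammer (of_nat (j * r + 1)) r) * fps_X ^ 2)"
proof -
  define b :: "nat \<Rightarrow> 'k fps"
    where "b j = fps_const (pochhammer (of_nat (j * r + 1)) r) * fps_X ^ 2" for j
  define g :: "nat \<Rightarrow> 'k fps"
    where "g k = Abs_fps (\<lambda>n. coeff (X_plus_D_iterate r (n + k)) (k * r))" for k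
  define f where "f k = (case k of 0 \<Rightarrow> 1 | Suc i \<Rightarrow> g i)" for k
  have g_nth: "fps_nth (g k) n = coeff (X_plus_D_iterate r (n + k)) (k * r)" for k n
    by (simp add: g_def)
  have bg: "fps_nth (b k * g (Suc k)) n = (if n = 0 then 0 else
      pochhammer (of_nat (k * r + 1)) r * coeff (X_plus_D_iterate r (n + k - 1)) (Suc k * r))"
    for k n
  proof (cases "n < 2")
    \<comment> \<open>For \<open>n = 1\<close> the right-hand side would belong to a path of \<open>k\<close> steps reaching height
      \<open>k + 1\<close>, so it vanishes like the coefficient of a multiple of \<open>z ^ 2\<close>.\<close>
    case True
    then have "coeff (X_plus_D_iterate r (n + k - 1) :: 'k poly) (Suc k * r) = 0" if "n \<noteq> 0"
      using that by (intro coeff_X_plus_D_iterate_eq_0[OF assms]) simp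
    then show ?thesis
      using True by (simp add: b_def mult.assoc fps_X_power_mult_nth)
  next
    case False
    then have "n - 2 + Suc k = n + k - 1" by simp
    then show ?thesis
      using False by (simp add: b_def g_nth mult.assoc fps_X_power_mult_nth del: mult_Suc)
  qed
  have rec: "f (Suc k) = f k + b k * f (Suc (Suc k))" for k
  proof (rule fps_ext)
    fix n
    show "fps_nth (f (Suc k)) n = fps_nth (f k + b k * f (Suc (Suc k))) n"
    proof (cases n)
      case 0
      then show ?thesis
        using coeff_X_plus_D_iterate_diag[OF assms, where 'k = 'k]
          coeff_X_plus_D_iterate_diag[OF assms, where 'k = 'k, of 0]
        by (cases k) (simp_all add: f_def b_def g_nth del: mult_Suc)
    next
      case (Suc i)
      then show ?thesis
        using coeff_X_plus_D_iterate_Suc[OF assms, where 'k = 'k, of "i + k" k]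
        by (cases k) (simp_all add: f_def bg g_nth del: mult_Suc)
    qed
  qed
  have "has_continued_fraction (f 1) b"
    by (rule three_term_recurrence_continued_fraction[where b = b and f = f, OF _ rec])
      (simp_all add: b_def f_def power2_eq_square)
  moreover have "f 1 = Abs_fps (\<lambda>n. coeff (X_plus_D_iterate r n) 0)" by (simp add: f_def g_def)
  ultimately show ?thesis unfolding b_def[abs_def] by simp
qed

theorem proposition15:
  fixes scale :: "'k::field_char_0 \<Rightarrow> 'a::ring_1 \<Rightarrow> 'a"
    and X D :: 'a
    and r :: nat
  assumes "weyl_pair scale X D"
    and "r \<ge> 1"
  shows "Abs_fps (\<lambda>n. CT scale X D ((X ^ r + D ^ r) ^ n)) =
           CT_fps scale X D (geometric (X ^ r + D ^ r)) \<and>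
         has_continued_fraction
           (CT_fps scale X D (geometric (X ^ r + D ^ r)))
           (\<lambda>j. fps_const (pochhammer (of_nat (j * r + 1)) r) * fps_X ^ 2)"
proof -
  have "CT_fps scale X D (geometric (X ^ r + D ^ r))
      = Abs_fps (\<lambda>n. coeff (X_plus_D_iterate r n) 0)"
    by (simp add: CT_fps_def geometric_def weyl_pair.CT_X_plus_D_power[OF assms(1)])
  then show ?thesis
    using continued_fraction_X_plus_D_iterate[OF assms(2), where 'k = 'k]
    by (simp add: CT_fps_def geometric_def)
qed

end
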